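(* Let $\mathbf{G}=(G,\delta,\epsilon)$ be a comonad on a category $\mathcal{A}$ and let $t_1=t:GG\Rightarrow GG$ be a strong braiding on $\mathbf{G}$. Define inductively $t_{n+1,M}:=t_{n,GM}\circ G^n(t_M)$. Then the $t_n:G^n\circ G\Rightarrow G\circ G^n$, $n\ge1$, form a sequence of distributive laws from $\mathbf{G}$ to the comonads $\mathbf{G}^n=(G^n,\delta^{(n)},\epsilon^{(n)})$, where the comultiplication is defined inductively by $\delta^{(1)}=\delta$ and $$\delta^{(n)}=G^{n-1}(t_{n-1,G})\circ\delta^{(n-1)}_{G^2}\circ G^{n-1}(\delta)=G^{n-1}(t_{n-1,G})\circ G^{2n-2}(\delta)\circ\delta^{(n-1)}_G,$$ and the counit is $\epsilon^{(n)}=\epsilon^{(n-1)}\circ G^{n-1}(\epsilon)=\epsilon\circ G(\epsilon)\circ\cdots\circ G^{n-1}(\epsilon)$ (with $\epsilon^{(1)}=\epsilon$). In formulas, for all $n\ge1$: $$G(\delta^{(n)})\,t_n=t_{n,G^n}\,G^n(t_n)\,\delta^{(n)}_G,$$ $$\delta_{G^n}\,t_n=G(t_n)\,t_{n,G}\,G^n(\delta),$$ $$(\epsilon^{(n)})_G=G(\epsilon^{(n)})\,t_n,$$ $$G^n(\epsilon)=\epsilon_{G^n}\,t_n.$$ The first identity is the case $l=n$ of the more general identity $$G^{n-l+1}(\delta^{(l)})\,t_n=t_{n+l}\,G^{n-l}(\delta^{(l)}_G),\qquad 1\le l\le n,$$ which also holds.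
   Context: For a natural transformation $\alpha$ and a functor $F$, $\alpha_F$ has components $\alpha_{F(M)}$ and $F(\alpha)$ has components $F(\alpha_M)$; in particular $t_{n,G^k}$ has components $t_{n,G^kM}$. A comonad $(G,\delta,\epsilon)$ on $\mathcal{A}$ consists of an endofunctor $G$ and natural transformations $\delta:G\Rightarrow GG$, $\epsilon:G\Rightarrow\mathrm{Id}_{\mathcal{A}}$ with $\delta_{G}\circ\delta=G(\delta)\circ\delta$ and $\epsilon_{G}\circ\delta=G(\epsilon)\circ\delta=1_{G}$. A strong braiding on $\mathbf{G}$ is a natural transformation $t:GG\Rightarrow GG$ satisfying the quantum Yang–Baxter equation $G(t_M)\circ t_{GM}\circ G(t_M)=t_{GM}\circ G(t_M)\circ t_{GM}$ for all objects $M$, and $$G(\epsilon)t=\epsilon_G,\quad \epsilon_Gt=G(\epsilon),\quad t_G\,G(t)\,\delta_G=G(\delta)\,t,\quad \delta_Gt=G(t)\,t_G\,G(\delta).$$ A distributive law from a comonad $\mathbf{G}=(G,\delta^G,\epsilon^G)$ to a comonad $\mathbf{F}=(F,\delta^F,\epsilon^F)$ is a natural transformation $l:F\circ G\Rightarrow G\circ F$ such that $$G(\epsilon^F)\circ l=(\epsilon^F)_G,\quad G(\delta^F)\circ l=l_F\circ F(l)\circ(\delta^F)_G,$$ $$(\epsilon^G)_F\circ l=F(\epsilon^G),\quad (\delta^G)_F\circ l=G(l)\circ l_G\circ F(\delta^G).$$ *)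

theory Defs
  imports Main
begin

record ('o, 'm) cat =
  Obj :: "'o set"
  Arr :: "'m set"
  Dom :: "'m \<Rightarrow> 'o"
  Cod :: "'m \<Rightarrow> 'o"
  Ide :: "'o \<Rightarrow> 'm"
  Comp :: "'m \<Rightarrow> 'm \<Rightarrow> 'm"  (infixr "\<odot>\<index>" 70)

definition Hom :: "('o, 'm, 'x) cat_scheme \<Rightarrow> 'o \<Rightarrow> 'o \<Rightarrow> 'm set" where
  "Hom A X Y = {f \<in> Arr A. Dom A f = X \<and> Cod A f = Y}"

locale category =
  fixes A :: "('o, 'm, 'x) cat_scheme" (structure)
  assumes Dom_Obj: "f \<in> Arr A \<Longrightarrow> Dom A f \<in> Obj A"
    and Cod_Obj: "f \<in> Arr A \<Longrightarrow> Cod A f \<in> Obj A"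
    and Ide_Hom: "X \<in> Obj A \<Longrightarrow> Ide A X \<in> Hom A X X"
    and Comp_Hom: "f \<in> Hom A X Y \<Longrightarrow> g \<in> Hom A Y Z \<Longrightarrow> g \<odot> f \<in> Hom A X Z"
    and Comp_Ide_left: "f \<in> Hom A X Y \<Longrightarrow> Ide A Y \<odot> f = f"
    and Comp_Ide_right: "f \<in> Hom A X Y \<Longrightarrow> f \<odot> Ide A X = f"
    and Comp_assoc: "f \<in> Hom A W X \<Longrightarrow> g \<in> Hom A X Y \<Longrightarrow> h \<in> Hom A Y Z \<Longrightarrow>
      (h \<odot> g) \<odot> f = h \<odot> (g \<odot> f)"

record ('o, 'm) endo =
  omap :: "'o \<Rightarrow> 'o"
  amap :: "'m \<Rightarrow> 'm"

locale endofunctor = category A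
  for A :: "('o, 'm, 'x) cat_scheme" (structure) +
  fixes F :: "('o, 'm) endo"
  assumes omap_Obj: "X \<in> Obj A \<Longrightarrow> omap F X \<in> Obj A"
    and amap_Hom: "f \<in> Hom A X Y \<Longrightarrow> amap F f \<in> Hom A (omap F X) (omap F Y)"
    and amap_Ide: "X \<in> Obj A \<Longrightarrow> amap F (Ide A X) = Ide A (omap F X)"
    and amap_Comp: "f \<in> Hom A X Y \<Longrightarrow> g \<in> Hom A Y Z \<Longrightarrow>
      amap F (g \<odot> f) = amap F g \<odot> amap F f"

definition endo_id :: "('o, 'm) endo" where
  "endo_id = \<lparr>omap = id, amap = id\<rparr>"

definition endo_comp :: "('o, 'm) endo \<Rightarrow> ('o, 'm) endo \<Rightarrow> ('o, 'm) endo"  (infixr "\<star>" 75) where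
  "F \<star> G = \<lparr>omap = omap F \<circ> omap G, amap = amap F \<circ> amap G\<rparr>"

definition endo_pow :: "('o, 'm) endo \<Rightarrow> nat \<Rightarrow> ('o, 'm) endo"  (infixr "\<up>" 80) where
  "G \<up> n = \<lparr>omap = omap G ^^ n, amap = amap G ^^ n\<rparr>"

text \<open>
  A natural transformation is given by its components \<open>\<tau> M\<close>; only those at objects of the
  category are constrained. Hence \<open>\<tau>\<close> whiskered by \<open>F\<close> on the right has components
  \<open>\<tau> (omap F M)\<close>, and whiskered by \<open>F\<close> on the left it has components \<open>amap F (\<tau> M)\<close>.
\<close>

locale natural_transformation = F: endofunctor A F + G: endofunctor A G
  for A :: "('o, 'm, 'x) cat_scheme" (structure) and F and G +
  fixes \<tau> :: "'o \<Rightarrow> 'm"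
  assumes component: "M \<in> Obj A \<Longrightarrow> \<tau> M \<in> Hom A (omap F M) (omap G M)"
    and natural: "f \<in> Hom A M N \<Longrightarrow> \<tau> N \<odot> amap F f = amap G f \<odot> \<tau> M"

locale comonad = endofunctor A G
  + comult: natural_transformation A G "G \<star> G" \<delta>
  + counit: natural_transformation A G endo_id \<epsilon>
  for A :: "('o, 'm, 'x) cat_scheme" (structure) and G and \<delta> and \<epsilon> +
  assumes coassoc: "M \<in> Obj A \<Longrightarrow> \<delta> (omap G M) \<odot> \<delta> M = amap G (\<delta> M) \<odot> \<delta> M"
    and counit_left: "M \<in> Obj A \<Longrightarrow> \<epsilon> (omap G M) \<odot> \<delta> M = Ide A (omap G M)"
    and counit_right: "M \<in> Obj A \<Longrightarrow> amap G (\<epsilon> M) \<odot> \<delta> M = Ide A (omap G M)"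

locale strong_braiding = comonad A G \<delta> \<epsilon>
  + braiding: natural_transformation A "G \<star> G" "G \<star> G" t
  for A :: "('o, 'm, 'x) cat_scheme" (structure) and G and \<delta> and \<epsilon> and t +
  assumes yang_baxter: "M \<in> Obj A \<Longrightarrow>
      amap G (t M) \<odot> t (omap G M) \<odot> amap G (t M) =
      t (omap G M) \<odot> amap G (t M) \<odot> t (omap G M)"
    and G_counit: "M \<in> Obj A \<Longrightarrow> amap G (\<epsilon> M) \<odot> t M = \<epsilon> (omap G M)"
    and counit_G: "M \<in> Obj A \<Longrightarrow> \<epsilon> (omap G M) \<odot> t M = amap G (\<epsilon> M)"
    and G_comult: "M \<in> Obj A \<Longrightarrow>
      t (omap G M) \<odot> amap G (t M) \<odot> \<delta> (omap G M) = amap G (\<delta> M) \<odot> t M"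
    and comult_G: "M \<in> Obj A \<Longrightarrow>
      \<delta> (omap G M) \<odot> t M = amap G (t M) \<odot> t (omap G M) \<odot> amap G (\<delta> M)"

text \<open>
  Distributive laws \<open>l : F \<circ> G \<Rightarrow> G \<circ> F\<close> from the comonad \<open>(G, \<delta>G, \<epsilon>G)\<close> to the comonad
  \<open>(F, \<delta>F, \<epsilon>F)\<close>.
\<close>

locale distributive_law = G: comonad A G \<delta>G \<epsilon>G + F: comonad A F \<delta>F \<epsilon>F
  + law: natural_transformation A "F \<star> G" "G \<star> F" l
  for A :: "('o, 'm, 'x) cat_scheme" (structure)
    and G and \<delta>G and \<epsilon>G and F and \<delta>F and \<epsilon>F and l +
  assumes counit_F: "M \<in> Obj A \<Longrightarrow> amap G (\<epsilon>F M) \<odot> l M = \<epsilon>F (omap G M)"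
    and comult_F: "M \<in> Obj A \<Longrightarrow>
      amap G (\<delta>F M) \<odot> l M = l (omap F M) \<odot> amap F (l M) \<odot> \<delta>F (omap G M)"
    and counit_G: "M \<in> Obj A \<Longrightarrow> \<epsilon>G (omap F M) \<odot> l M = amap F (\<epsilon>G M)"
    and comult_G: "M \<in> Obj A \<Longrightarrow>
      \<delta>G (omap F M) \<odot> l M = amap G (l M) \<odot> l (omap G M) \<odot> amap F (\<delta>G M)"

text \<open>
  The three sequences start at index 1; the values at 0 are the identities, by convention only.
\<close>

fun braid_seq ::
  "('o, 'm, 'x) cat_scheme \<Rightarrow> ('o, 'm) endo \<Rightarrow> ('o \<Rightarrow> 'm) \<Rightarrow> nat \<Rightarrow> 'o \<Rightarrow> 'm" where
  "braid_seq A G t 0 M = Ide A (omap G M)"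
| "braid_seq A G t (Suc 0) M = t M"
| "braid_seq A G t (Suc (Suc n)) M =
    braid_seq A G t (Suc n) (omap G M) \<odot>\<^bsub>A\<^esub> amap (G \<up> Suc n) (t M)"

fun comult_seq ::
  "('o, 'm, 'x) cat_scheme \<Rightarrow> ('o, 'm) endo \<Rightarrow> ('o \<Rightarrow> 'm) \<Rightarrow> ('o \<Rightarrow> 'm) \<Rightarrow> nat \<Rightarrow> 'o \<Rightarrow> 'm" where
  "comult_seq A G \<delta> t 0 M = Ide A M"
| "comult_seq A G \<delta> t (Suc 0) M = \<delta> M"
| "comult_seq A G \<delta> t (Suc (Suc n)) M =
    amap (G \<up> Suc n) (braid_seq A G t (Suc n) (omap G M)) \<odot>\<^bsub>A\<^esub>
    comult_seq A G \<delta> t (Suc n) (omap (G \<up> 2) M) \<odot>\<^bsub>A\<^esub>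
    amap (G \<up> Suc n) (\<delta> M)"

fun counit_seq ::
  "('o, 'm, 'x) cat_scheme \<Rightarrow> ('o, 'm) endo \<Rightarrow> ('o \<Rightarrow> 'm) \<Rightarrow> nat \<Rightarrow> 'o \<Rightarrow> 'm" where
  "counit_seq A G \<epsilon> 0 M = Ide A M"
| "counit_seq A G \<epsilon> (Suc 0) M = \<epsilon> M"
| "counit_seq A G \<epsilon> (Suc (Suc n)) M =
    counit_seq A G \<epsilon> (Suc n) M \<odot>\<^bsub>A\<^esub> amap (G \<up> Suc n) (\<epsilon> M)"

end

theory Submission
  imports Defs
begin

text \<open>
  Since \<open>G\<^bsup>n+1\<^esup> = G\<^sup>n G\<close>, the powers of \<open>G\<close> are built one factor at a time, and the given formulas
  for \<open>\<delta>\<close> and \<open>\<epsilon>\<close> on \<open>G\<^bsup>n+1\<^esup>\<close> are those of Beck's composite: a distributive law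
  \<open>l : F G \<Rightarrow> G F\<close> from \<open>G\<close> to \<open>F\<close> makes \<open>F G\<close> a comonad with comultiplication
  \<open>F(l\<^sub>G) \<circ> \<delta>\<^sup>F\<^bsub>GG\<^esub> \<circ> F(\<delta>\<^sup>G)\<close> and counit \<open>\<epsilon>\<^sup>F \<circ> F(\<epsilon>\<^sup>G)\<close> (\<open>composite_comonad\<close>). Taking \<open>F = G\<^sup>n\<close> and
  \<open>l = t\<^sub>n\<close>, the powers are comonads as soon as every \<open>t\<^sub>n\<close> is a distributive law.

  That in turn is an instance of a second fact about composites: if a comonad \<open>H\<close> has distributive
  laws \<open>k\<close> to \<open>G\<close> and \<open>m\<close> to \<open>F\<close>, and \<open>k\<close>, \<open>l\<close>, \<open>m\<close> satisfy the hexagon, that is, the two ways of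
  reversing \<open>F G H\<close> to \<open>H G F\<close> agree, then \<open>m\<^sub>G \<circ> F(k)\<close> is a distributive law from \<open>H\<close> to \<open>F G\<close>
  (\<open>composite_distributive_law\<close>). For \<open>H = G\<close>, \<open>k = t\<close>, \<open>m = l = t\<^sub>n\<close> this law is \<open>t\<^bsub>n+1\<^esub>\<close>. The axioms
  of a strong braiding other than Yang--Baxter say that \<open>t\<close> is a distributive law from \<open>G\<close> to
  itself; Yang--Baxter is the hexagon for \<open>n = 1\<close>, and the hexagon passes from \<open>n\<close> to \<open>n + 1\<close>. Both
  properties of \<open>t\<^sub>n\<close> thus follow in one induction (\<open>braid_distributive_law_and_hexagon\<close>).

  The identity for \<open>\<delta>\<^bsup>(l)\<^esup>\<close> with \<open>l \<le> n\<close> then comes from the case \<open>l = n\<close> by splitting the braid,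
  \<open>t\<^bsub>k+l,M\<^esub> = t\<^bsub>k,G\<^sup>lM\<^esub> \<circ> G\<^sup>k(t\<^bsub>l,M\<^esub>)\<close> (\<open>braid_add\<close>), and moving \<open>\<delta>\<^bsup>(l)\<^esup>\<close> past \<open>t\<^sub>k\<close> by naturality.
\<close>

notation omap  (infixr "\<cdot>" 90)
notation amap  (infixr "\<bullet>" 90)

section \<open>Composites of arrows\<close>

text \<open>
  The rules for composites are stated with \<open>Dom\<close> and \<open>Cod\<close> instead of hom-sets: their premises then
  contain no variables beyond those of the conclusion, so that rewriting can discharge them. With
  functoriality used from left to right, every composite below normalizes to a right-nested
  composite of whiskered components. An equation that is to be applied inside a composite is
  therefore first exposed as a parenthesized factor.
\<close>

context category
begin

lemma Comp_Arr [simp]: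
  assumes "f \<in> Arr A" "g \<in> Arr A" "Cod A f = Dom A g"
  shows "g \<odot> f \<in> Arr A" "Dom A (g \<odot> f) = Dom A f" "Cod A (g \<odot> f) = Cod A g"
  using Comp_Hom[of f "Dom A f" "Cod A f" g "Cod A g"] assms by (auto simp: Hom_def)

lemma Ide_Arr [simp]:
  assumes "X \<in> Obj A"
  shows "Ide A X \<in> Arr A" "Dom A (Ide A X) = X" "Cod A (Ide A X) = X"
  using Ide_Hom[OF assms] by (auto simp: Hom_def)

lemma Ide_Comp [simp]: "f \<in> Arr A \<Longrightarrow> Cod A f = Y \<Longrightarrow> Ide A Y \<odot> f = f"
  using Comp_Ide_left[of f "Dom A f"] by (auto simp: Hom_def)

lemma Comp_Ide [simp]: "f \<in> Arr A \<Longrightarrow> Dom A f = X \<Longrightarrow> f \<odot> Ide A X = f"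
  using Comp_Ide_right[of f _ "Cod A f"] by (auto simp: Hom_def)

lemma Comp_reassoc [simp]:
  "f \<in> Arr A \<Longrightarrow> g \<in> Arr A \<Longrightarrow> h \<in> Arr A \<Longrightarrow> Cod A f = Dom A g \<Longrightarrow> Cod A g = Dom A h \<Longrightarrow>
    (h \<odot> g) \<odot> f = h \<odot> g \<odot> f"
  using Comp_assoc[of f "Dom A f" "Cod A f" g "Cod A g" h "Cod A h"] by (auto simp: Hom_def)

lemmas Dom_Cod_Obj [simp] = Dom_Obj Cod_Obj

end

section \<open>Composites of endofunctors\<close>

lemma endo_comp_apply [simp]:
  "(F \<star> G) \<cdot> M = F \<cdot> G \<cdot> M" "(F \<star> G) \<bullet> f = F \<bullet> G \<bullet> f"
  by (simp_all add: endo_comp_def)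

lemma endo_id_apply [simp]: "endo_id \<cdot> M = M" "endo_id \<bullet> f = f"
  by (simp_all add: endo_id_def)

lemma endo_pow_0 [simp]: "(G \<up> 0) \<cdot> M = M" "(G \<up> 0) \<bullet> f = f"
  by (simp_all add: endo_pow_def)

lemma endo_pow_1 [simp]: "G \<up> Suc 0 = G"
  by (simp add: endo_pow_def)

lemma endo_pow_Suc: "G \<up> Suc n = (G \<up> n) \<star> G"
  by (simp add: endo_pow_def endo_comp_def funpow_Suc_right del: funpow.simps)

lemma endo_pow_add: "G \<up> (m + n) = (G \<up> m) \<star> (G \<up> n)"
  by (simp add: endo_pow_def endo_comp_def funpow_add)

lemma endo_pow_commute: "(G \<up> n) \<star> G = G \<star> (G \<up> n)"
  by (simp add: endo_pow_def endo_comp_def flip: funpow_Suc_right)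

lemma endo_pow_swap:
  "(G \<up> n) \<cdot> G \<cdot> M = G \<cdot> (G \<up> n) \<cdot> M" "(G \<up> n) \<bullet> G \<bullet> f = G \<bullet> (G \<up> n) \<bullet> f"
  by (simp_all flip: endo_comp_apply endo_pow_commute)

context endofunctor
begin

lemmas omap_Obj_simp [simp] = omap_Obj
lemmas amap_Ide_simp [simp] = amap_Ide

lemma amap_Arr [simp]:
  assumes "f \<in> Arr A"
  shows "F \<bullet> f \<in> Arr A" "Dom A (F \<bullet> f) = F \<cdot> Dom A f" "Cod A (F \<bullet> f) = F \<cdot> Cod A f"
  using amap_Hom[of f "Dom A f" "Cod A f"] assms by (auto simp: Hom_def)

lemma amap_Comp_simp [simp]:
  "f \<in> Arr A \<Longrightarrow> g \<in> Arr A \<Longrightarrow> Cod A f = Dom A g \<Longrightarrow> F \<bullet> (g \<odot> f) = F \<bullet> g \<odot> F \<bullet> f"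
  using amap_Comp[of f "Dom A f" "Cod A f" g "Cod A g"] by (auto simp: Hom_def)

end

lemma endofunctor_comp:
  assumes "endofunctor A F" "endofunctor A G"
  shows "endofunctor A (F \<star> G)"
proof -
  interpret F: endofunctor A F by fact
  interpret G: endofunctor A G by fact
  show ?thesis by unfold_locales (auto simp: Hom_def)
qed

context natural_transformation
begin

lemma component_Arr [simp]:
  assumes "M \<in> Obj A"
  shows "\<tau> M \<in> Arr A" "Dom A (\<tau> M) = F \<cdot> M" "Cod A (\<tau> M) = G \<cdot> M"
  using component[OF assms] by (auto simp: Hom_def)

lemma naturality:
  "f \<in> Arr A \<Longrightarrow> Dom A f = M \<Longrightarrow> Cod A f = N \<Longrightarrow> \<tau> N \<odot> F \<bullet> f = G \<bullet> f \<odot> \<tau> M"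
  using natural[of f M N] by (auto simp: Hom_def)

end

section \<open>The comonad of a distributive law\<close>

definition composite_comult ::
  "('o, 'm, 'x) cat_scheme \<Rightarrow> ('o, 'm) endo \<Rightarrow> ('o \<Rightarrow> 'm) \<Rightarrow> ('o, 'm) endo \<Rightarrow> ('o \<Rightarrow> 'm) \<Rightarrow>
    ('o \<Rightarrow> 'm) \<Rightarrow> 'o \<Rightarrow> 'm" where
  "composite_comult A G \<delta>G F \<delta>F l M =
    F \<bullet> l (G \<cdot> M) \<odot>\<^bsub>A\<^esub> \<delta>F (G \<cdot> G \<cdot> M) \<odot>\<^bsub>A\<^esub> F \<bullet> \<delta>G M"

definition composite_counit ::
  "('o, 'm, 'x) cat_scheme \<Rightarrow> ('o \<Rightarrow> 'm) \<Rightarrow> ('o, 'm) endo \<Rightarrow> ('o \<Rightarrow> 'm) \<Rightarrow> 'o \<Rightarrow> 'm" where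
  "composite_counit A \<epsilon>G F \<epsilon>F M = \<epsilon>F M \<odot>\<^bsub>A\<^esub> F \<bullet> \<epsilon>G M"

context distributive_law
begin

text \<open>
  Both sides of coassociativity become ``two comultiplications of \<open>G\<close>, then two of \<open>F\<close>, then
  a shuffle made of three components of \<open>l\<close>''; the two shuffles agree by naturality of \<open>l\<close>.
\<close>

lemma composite_coassoc:
  assumes M [simp]: "M \<in> Obj A"
  defines "\<Delta> \<equiv> composite_comult A G \<delta>G F \<delta>F l"
  shows "\<Delta> (F \<cdot> G \<cdot> M) \<odot> \<Delta> M = F \<bullet> G \<bullet> \<Delta> M \<odot> \<Delta> M"
proof -
  let ?GM = "G \<cdot> M" and ?GGM = "G \<cdot> G \<cdot> M"
  let ?shuffle = "F \<bullet> l (G \<cdot> F \<cdot> ?GM) \<odot> F \<bullet> F \<bullet> G \<bullet> l ?GM \<odot> F \<bullet> F \<bullet> l ?GGM"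
  have "\<Delta> (F \<cdot> G \<cdot> M) \<odot> \<Delta> M =
      F \<bullet> l (G \<cdot> F \<cdot> ?GM) \<odot> \<delta>F (G \<cdot> G \<cdot> F \<cdot> ?GM) \<odot>
      F \<bullet> (\<delta>G (F \<cdot> ?GM) \<odot> l ?GM) \<odot> \<delta>F ?GGM \<odot> F \<bullet> \<delta>G M"
    by (simp add: \<Delta>_def composite_comult_def)
  also have "\<dots> = F \<bullet> l (G \<cdot> F \<cdot> ?GM) \<odot>
      (\<delta>F (G \<cdot> G \<cdot> F \<cdot> ?GM) \<odot> F \<bullet> (G \<bullet> l ?GM \<odot> l ?GGM)) \<odot>
      (F \<star> F) \<bullet> \<delta>G ?GM \<odot> \<delta>F ?GGM \<odot> F \<bullet> \<delta>G M"
    by (simp add: comult_G)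
  also have "\<dots> = F \<bullet> l (G \<cdot> F \<cdot> ?GM) \<odot>
      ((F \<star> F) \<bullet> (G \<bullet> l ?GM \<odot> l ?GGM) \<odot> \<delta>F (F \<cdot> G \<cdot> ?GGM)) \<odot>
      ((F \<star> F) \<bullet> \<delta>G ?GM \<odot> \<delta>F ?GGM) \<odot> F \<bullet> \<delta>G M"
    by (subst F.comult.naturality) simp_all+
  also have "\<dots> = F \<bullet> l (G \<cdot> F \<cdot> ?GM) \<odot>
      ((F \<star> F) \<bullet> (G \<bullet> l ?GM \<odot> l ?GGM) \<odot> \<delta>F (F \<cdot> G \<cdot> ?GGM)) \<odot>
      (\<delta>F (G \<cdot> ?GGM) \<odot> F \<bullet> \<delta>G ?GM) \<odot> F \<bullet> \<delta>G M"
    by (subst F.comult.naturality[symmetric]) simp_all+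
  also have "\<dots> = ?shuffle \<odot> (\<delta>F (F \<cdot> G \<cdot> ?GGM) \<odot> \<delta>F (G \<cdot> ?GGM)) \<odot>
      F \<bullet> (\<delta>G ?GM \<odot> \<delta>G M)"
    by simp
  also have "\<dots> = ?shuffle \<odot> (F \<bullet> \<delta>F (G \<cdot> ?GGM) \<odot> \<delta>F (G \<cdot> ?GGM)) \<odot>
      F \<bullet> (G \<bullet> \<delta>G M \<odot> \<delta>G M)"
    by (simp only: F.coassoc G.coassoc M G.omap_Obj)
  finally have left: "\<Delta> (F \<cdot> G \<cdot> M) \<odot> \<Delta> M = \<dots>" .
  have "F \<bullet> G \<bullet> \<Delta> M \<odot> \<Delta> M =
      F \<bullet> G \<bullet> F \<bullet> l ?GM \<odot> F \<bullet> G \<bullet> \<delta>F ?GGM \<odot>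
      F \<bullet> ((G \<star> F) \<bullet> \<delta>G M \<odot> l ?GM) \<odot> \<delta>F ?GGM \<odot> F \<bullet> \<delta>G M"
    by (simp add: \<Delta>_def composite_comult_def)
  also have "\<dots> = F \<bullet> G \<bullet> F \<bullet> l ?GM \<odot> F \<bullet> G \<bullet> \<delta>F ?GGM \<odot>
      F \<bullet> (l ?GGM \<odot> (F \<star> G) \<bullet> \<delta>G M) \<odot> \<delta>F ?GGM \<odot> F \<bullet> \<delta>G M"
    by (subst law.naturality[symmetric]) simp_all+
  also have "\<dots> = F \<bullet> G \<bullet> F \<bullet> l ?GM \<odot> F \<bullet> (G \<bullet> \<delta>F ?GGM \<odot> l ?GGM) \<odot>
      ((F \<star> F) \<bullet> G \<bullet> \<delta>G M \<odot> \<delta>F ?GGM) \<odot> F \<bullet> \<delta>G M"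
    by simp
  also have "\<dots> = F \<bullet> G \<bullet> F \<bullet> l ?GM \<odot>
      F \<bullet> (l (F \<cdot> ?GGM) \<odot> F \<bullet> l ?GGM \<odot> \<delta>F (G \<cdot> ?GGM)) \<odot>
      (\<delta>F (G \<cdot> ?GGM) \<odot> F \<bullet> G \<bullet> \<delta>G M) \<odot> F \<bullet> \<delta>G M"
    by (subst F.comult.naturality[symmetric]) (simp_all only: comult_F M G.omap_Obj, simp_all+)
  also have "\<dots> = F \<bullet> ((G \<star> F) \<bullet> l ?GM \<odot> l (F \<cdot> ?GGM)) \<odot> F \<bullet> F \<bullet> l ?GGM \<odot>
      (F \<bullet> \<delta>F (G \<cdot> ?GGM) \<odot> \<delta>F (G \<cdot> ?GGM)) \<odot> F \<bullet> (G \<bullet> \<delta>G M \<odot> \<delta>G M)"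
    by simp
  also have "\<dots> = F \<bullet> (l (G \<cdot> F \<cdot> ?GM) \<odot> (F \<star> G) \<bullet> l ?GM) \<odot> F \<bullet> F \<bullet> l ?GGM \<odot>
      (F \<bullet> \<delta>F (G \<cdot> ?GGM) \<odot> \<delta>F (G \<cdot> ?GGM)) \<odot> F \<bullet> (G \<bullet> \<delta>G M \<odot> \<delta>G M)"
    by (subst law.naturality[symmetric]) simp_all+
  also have "\<dots> = \<Delta> (F \<cdot> G \<cdot> M) \<odot> \<Delta> M"
    by (simp add: left)
  finally show ?thesis by (rule sym)
qed

text \<open>
  In both counit laws the counits of \<open>F\<close> and \<open>G\<close> cancel the respective comultiplications, once the
  counit axioms have removed \<open>l\<close> and naturality has moved \<open>\<epsilon>\<^sup>G\<close> past \<open>\<delta>\<^sup>F\<close>.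
\<close>

lemma composite_counit_left:
  assumes M [simp]: "M \<in> Obj A"
  shows "composite_counit A \<epsilon>G F \<epsilon>F (F \<cdot> G \<cdot> M) \<odot> composite_comult A G \<delta>G F \<delta>F l M =
    Ide A (F \<cdot> G \<cdot> M)"
proof -
  let ?GM = "G \<cdot> M" and ?GGM = "G \<cdot> G \<cdot> M"
  have "composite_counit A \<epsilon>G F \<epsilon>F (F \<cdot> ?GM) \<odot> composite_comult A G \<delta>G F \<delta>F l M =
      \<epsilon>F (F \<cdot> ?GM) \<odot> F \<bullet> (\<epsilon>G (F \<cdot> ?GM) \<odot> l ?GM) \<odot> \<delta>F ?GGM \<odot> F \<bullet> \<delta>G M"
    by (simp add: composite_counit_def composite_comult_def)
  also have "\<dots> = \<epsilon>F (F \<cdot> ?GM) \<odot> ((F \<star> F) \<bullet> \<epsilon>G ?GM \<odot> \<delta>F ?GGM) \<odot> F \<bullet> \<delta>G M"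
    by (simp add: counit_G)
  also have "\<dots> = \<epsilon>F (F \<cdot> ?GM) \<odot> (\<delta>F ?GM \<odot> F \<bullet> \<epsilon>G ?GM) \<odot> F \<bullet> \<delta>G M"
    by (subst F.comult.naturality[symmetric]) simp_all+
  also have "\<dots> = (\<epsilon>F (F \<cdot> ?GM) \<odot> \<delta>F ?GM) \<odot> F \<bullet> (\<epsilon>G ?GM \<odot> \<delta>G M)"
    by simp
  also have "\<dots> = Ide A (F \<cdot> ?GM)"
    by (simp only: F.counit_left G.counit_left M G.omap_Obj, simp)
  finally show ?thesis .
qed

lemma composite_counit_right:
  assumes M [simp]: "M \<in> Obj A"
  shows "F \<bullet> G \<bullet> composite_counit A \<epsilon>G F \<epsilon>F M \<odot> composite_comult A G \<delta>G F \<delta>F l M =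
    Ide A (F \<cdot> G \<cdot> M)"
proof -
  let ?GM = "G \<cdot> M" and ?GGM = "G \<cdot> G \<cdot> M"
  have "F \<bullet> G \<bullet> composite_counit A \<epsilon>G F \<epsilon>F M \<odot> composite_comult A G \<delta>G F \<delta>F l M =
      F \<bullet> G \<bullet> \<epsilon>F M \<odot> F \<bullet> ((G \<star> F) \<bullet> \<epsilon>G M \<odot> l ?GM) \<odot> \<delta>F ?GGM \<odot> F \<bullet> \<delta>G M"
    by (simp add: composite_counit_def composite_comult_def)
  also have "\<dots> = F \<bullet> G \<bullet> \<epsilon>F M \<odot> F \<bullet> (l M \<odot> (F \<star> G) \<bullet> \<epsilon>G M) \<odot> \<delta>F ?GGM \<odot> F \<bullet> \<delta>G M"
    by (subst law.naturality[symmetric]) simp_all+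
  also have "\<dots> = F \<bullet> (G \<bullet> \<epsilon>F M \<odot> l M) \<odot> ((F \<star> F) \<bullet> G \<bullet> \<epsilon>G M \<odot> \<delta>F ?GGM) \<odot> F \<bullet> \<delta>G M"
    by simp
  also have "\<dots> = F \<bullet> \<epsilon>F ?GM \<odot> (\<delta>F ?GM \<odot> F \<bullet> G \<bullet> \<epsilon>G M) \<odot> F \<bullet> \<delta>G M"
    by (subst F.comult.naturality[symmetric]) (simp_all only: counit_F M G.omap_Obj, simp_all+)
  also have "\<dots> = (F \<bullet> \<epsilon>F ?GM \<odot> \<delta>F ?GM) \<odot> F \<bullet> (G \<bullet> \<epsilon>G M \<odot> \<delta>G M)"
    by simp
  also have "\<dots> = Ide A (F \<cdot> ?GM)"
    by (simp only: F.counit_right G.counit_right M G.omap_Obj, simp)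
  finally show ?thesis .
qed

lemma composite_comult_natural:
  assumes f [simp]: "f \<in> Arr A" "Dom A f = M" "Cod A f = N"
  shows "composite_comult A G \<delta>G F \<delta>F l N \<odot> F \<bullet> G \<bullet> f =
    F \<bullet> G \<bullet> F \<bullet> G \<bullet> f \<odot> composite_comult A G \<delta>G F \<delta>F l M"
proof -
  have [simp]: "M \<in> Obj A" "N \<in> Obj A"
    using f G.Dom_Obj[of f] G.Cod_Obj[of f] by auto
  have "composite_comult A G \<delta>G F \<delta>F l N \<odot> F \<bullet> G \<bullet> f =
      F \<bullet> l (G \<cdot> N) \<odot> \<delta>F (G \<cdot> G \<cdot> N) \<odot> F \<bullet> (\<delta>G N \<odot> G \<bullet> f)"
    by (simp add: composite_comult_def)
  also have "\<dots> = F \<bullet> l (G \<cdot> N) \<odot> (\<delta>F (G \<cdot> G \<cdot> N) \<odot> F \<bullet> G \<bullet> G \<bullet> f) \<odot> F \<bullet> \<delta>G M"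
    by (subst G.comult.naturality) simp_all+
  also have "\<dots> = F \<bullet> (l (G \<cdot> N) \<odot> (F \<star> G) \<bullet> G \<bullet> f) \<odot> \<delta>F (G \<cdot> G \<cdot> M) \<odot> F \<bullet> \<delta>G M"
    by (subst F.comult.naturality) simp_all+
  also have "\<dots> = F \<bullet> G \<bullet> F \<bullet> G \<bullet> f \<odot> composite_comult A G \<delta>G F \<delta>F l M"
    by (subst law.naturality) (simp_all add: composite_comult_def)+
  finally show ?thesis .
qed

lemma composite_counit_natural:
  assumes f [simp]: "f \<in> Arr A" "Dom A f = M" "Cod A f = N"
  shows "composite_counit A \<epsilon>G F \<epsilon>F N \<odot> F \<bullet> G \<bullet> f = f \<odot> composite_counit A \<epsilon>G F \<epsilon>F M"
proof -
  have [simp]: "M \<in> Obj A" "N \<in> Obj A"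
    using f G.Dom_Obj[of f] G.Cod_Obj[of f] by auto
  have "composite_counit A \<epsilon>G F \<epsilon>F N \<odot> F \<bullet> G \<bullet> f = \<epsilon>F N \<odot> F \<bullet> (\<epsilon>G N \<odot> G \<bullet> f)"
    by (simp add: composite_counit_def)
  also have "\<dots> = (\<epsilon>F N \<odot> F \<bullet> f) \<odot> F \<bullet> \<epsilon>G M"
    by (subst G.counit.naturality) simp_all+
  also have "\<dots> = f \<odot> composite_counit A \<epsilon>G F \<epsilon>F M"
    by (subst F.counit.naturality) (simp_all add: composite_counit_def)+
  finally show ?thesis .
qed

theorem composite_comonad:
  "comonad A (F \<star> G) (composite_comult A G \<delta>G F \<delta>F l) (composite_counit A \<epsilon>G F \<epsilon>F)"
proof -
  interpret FG: endofunctor A "F \<star> G"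
    by (rule law.F.endofunctor_axioms)
  interpret FGFG: endofunctor A "(F \<star> G) \<star> F \<star> G"
    by (intro endofunctor_comp law.F.endofunctor_axioms)
  show ?thesis
  proof unfold_locales
    fix M assume M [simp]: "M \<in> Obj A"
    show "composite_comult A G \<delta>G F \<delta>F l M \<in> Hom A ((F \<star> G) \<cdot> M) (((F \<star> G) \<star> F \<star> G) \<cdot> M)"
      by (simp add: Hom_def composite_comult_def)
    show "composite_counit A \<epsilon>G F \<epsilon>F M \<in> Hom A ((F \<star> G) \<cdot> M) (endo_id \<cdot> M)"
      by (simp add: Hom_def composite_counit_def)
  qed (auto simp: Hom_def composite_coassoc composite_counit_left composite_counit_right
      composite_comult_natural composite_counit_natural)
qed

end

section \<open>Distributive laws over a composite comonad\<close>

text \<open>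
  The two axioms for \<open>\<delta>\<^sup>H\<close> and \<open>\<epsilon>\<^sup>H\<close> and the counit axiom for \<open>F G\<close> combine those of \<open>k\<close> and \<open>m\<close> by
  naturality. The comultiplication of \<open>F G\<close> contains \<open>l\<close>, and after the axioms of \<open>k\<close> and \<open>m\<close> have
  been applied, \<open>H\<close> still has to be moved through this \<open>l\<close>: that is the hexagon.
\<close>

theorem composite_distributive_law:
  fixes A (structure)
  assumes l: "distributive_law A G \<delta>G \<epsilon>G F \<delta>F \<epsilon>F l"
    and k: "distributive_law A H \<delta>H \<epsilon>H G \<delta>G \<epsilon>G k"
    and m: "distributive_law A H \<delta>H \<epsilon>H F \<delta>F \<epsilon>F m"
    and hexagon: "\<And>M. M \<in> Obj A \<Longrightarrow>
      H \<bullet> l M \<odot> m (G \<cdot> M) \<odot> F \<bullet> k M = k (F \<cdot> M) \<odot> G \<bullet> m M \<odot> l (H \<cdot> M)"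
  shows "distributive_law A H \<delta>H \<epsilon>H (F \<star> G)
    (composite_comult A G \<delta>G F \<delta>F l) (composite_counit A \<epsilon>G F \<epsilon>F)
    (\<lambda>M. m (G \<cdot> M) \<odot> F \<bullet> k M)"
proof -
  interpret l: distributive_law A G \<delta>G \<epsilon>G F \<delta>F \<epsilon>F l by fact
  interpret k: distributive_law A H \<delta>H \<epsilon>H G \<delta>G \<epsilon>G k by fact
  interpret m: distributive_law A H \<delta>H \<epsilon>H F \<delta>F \<epsilon>F m by fact
  interpret FG: comonad A "F \<star> G" "composite_comult A G \<delta>G F \<delta>F l" "composite_counit A \<epsilon>G F \<epsilon>F"
    by (rule l.composite_comonad)
  interpret FGH: endofunctor A "(F \<star> G) \<star> H"
    by (intro endofunctor_comp l.law.F.endofunctor_axioms k.G.endofunctor_axioms)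
  interpret HFG: endofunctor A "H \<star> F \<star> G"
    by (intro endofunctor_comp l.law.F.endofunctor_axioms k.G.endofunctor_axioms)
  show ?thesis
  proof unfold_locales
    fix M assume M [simp]: "M \<in> Obj A"
    let ?GM = "G \<cdot> M" and ?GGM = "G \<cdot> G \<cdot> M" and ?HM = "H \<cdot> M"
    show "m ?GM \<odot> F \<bullet> k M \<in> Hom A (((F \<star> G) \<star> H) \<cdot> M) ((H \<star> F \<star> G) \<cdot> M)"
      by (simp add: Hom_def)

    have "H \<bullet> composite_counit A \<epsilon>G F \<epsilon>F M \<odot> m ?GM \<odot> F \<bullet> k M =
        H \<bullet> \<epsilon>F M \<odot> ((H \<star> F) \<bullet> \<epsilon>G M \<odot> m ?GM) \<odot> F \<bullet> k M"
      by (simp add: composite_counit_def)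
    also have "\<dots> = (H \<bullet> \<epsilon>F M \<odot> m M) \<odot> F \<bullet> (H \<bullet> \<epsilon>G M \<odot> k M)"
      by (subst m.law.naturality[symmetric]) simp_all+
    also have "\<dots> = composite_counit A \<epsilon>G F \<epsilon>F ?HM"
      by (simp only: m.counit_F k.counit_F M, simp add: composite_counit_def)
    finally show "H \<bullet> composite_counit A \<epsilon>G F \<epsilon>F M \<odot> m ?GM \<odot> F \<bullet> k M =
        composite_counit A \<epsilon>G F \<epsilon>F ?HM" .

    have "H \<bullet> composite_comult A G \<delta>G F \<delta>F l M \<odot> m ?GM \<odot> F \<bullet> k M =
        H \<bullet> F \<bullet> l ?GM \<odot> H \<bullet> \<delta>F ?GGM \<odot> ((H \<star> F) \<bullet> \<delta>G M \<odot> m ?GM) \<odot> F \<bullet> k M"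
      by (simp add: composite_comult_def)
    also have "\<dots> = H \<bullet> F \<bullet> l ?GM \<odot> (H \<bullet> \<delta>F ?GGM \<odot> m ?GGM) \<odot> F \<bullet> (H \<bullet> \<delta>G M \<odot> k M)"
      by (subst m.law.naturality[symmetric]) simp_all+
    also have "\<dots> = H \<bullet> F \<bullet> l ?GM \<odot> (m (F \<cdot> ?GGM) \<odot> F \<bullet> m ?GGM \<odot> \<delta>F (H \<cdot> ?GGM)) \<odot>
        F \<bullet> (k ?GM \<odot> G \<bullet> k M \<odot> \<delta>G ?HM)"
      by (simp only: m.comult_F k.comult_F M l.G.omap_Obj)
    also have "\<dots> = ((H \<star> F) \<bullet> l ?GM \<odot> m (F \<cdot> ?GGM)) \<odot> F \<bullet> m ?GGM \<odot>
        (\<delta>F (H \<cdot> ?GGM) \<odot> F \<bullet> (k ?GM \<odot> G \<bullet> k M)) \<odot> F \<bullet> \<delta>G ?HM"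
      by simp
    also have "\<dots> = ((H \<star> F) \<bullet> l ?GM \<odot> m (F \<cdot> ?GGM)) \<odot> F \<bullet> m ?GGM \<odot>
        ((F \<star> F) \<bullet> (k ?GM \<odot> G \<bullet> k M) \<odot> \<delta>F (G \<cdot> G \<cdot> ?HM)) \<odot> F \<bullet> \<delta>G ?HM"
      by (subst l.F.comult.naturality) simp_all+
    also have "\<dots> = (m (G \<cdot> F \<cdot> ?GM) \<odot> (F \<star> H) \<bullet> l ?GM) \<odot> F \<bullet> m ?GGM \<odot>
        ((F \<star> F) \<bullet> (k ?GM \<odot> G \<bullet> k M) \<odot> \<delta>F (G \<cdot> G \<cdot> ?HM)) \<odot> F \<bullet> \<delta>G ?HM"
      by (subst m.law.naturality[symmetric]) simp_all+
    also have "\<dots> = m (G \<cdot> F \<cdot> ?GM) \<odot> F \<bullet> (H \<bullet> l ?GM \<odot> m ?GGM \<odot> F \<bullet> k ?GM) \<odot>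
        F \<bullet> F \<bullet> G \<bullet> k M \<odot> \<delta>F (G \<cdot> G \<cdot> ?HM) \<odot> F \<bullet> \<delta>G ?HM"
      by simp
    also have "\<dots> = m (G \<cdot> F \<cdot> ?GM) \<odot> F \<bullet> (k (F \<cdot> ?GM) \<odot> G \<bullet> m ?GM \<odot> l (H \<cdot> ?GM)) \<odot>
        F \<bullet> F \<bullet> G \<bullet> k M \<odot> \<delta>F (G \<cdot> G \<cdot> ?HM) \<odot> F \<bullet> \<delta>G ?HM"
      by (simp only: hexagon M l.G.omap_Obj)
    also have "\<dots> = m (G \<cdot> F \<cdot> ?GM) \<odot> F \<bullet> k (F \<cdot> ?GM) \<odot> F \<bullet> G \<bullet> m ?GM \<odot>
        F \<bullet> (l (H \<cdot> ?GM) \<odot> (F \<star> G) \<bullet> k M) \<odot> \<delta>F (G \<cdot> G \<cdot> ?HM) \<odot> F \<bullet> \<delta>G ?HM"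
      by simp
    also have "\<dots> = m (G \<cdot> F \<cdot> ?GM) \<odot> F \<bullet> k (F \<cdot> ?GM) \<odot> F \<bullet> G \<bullet> m ?GM \<odot>
        F \<bullet> ((G \<star> F) \<bullet> k M \<odot> l (G \<cdot> ?HM)) \<odot> \<delta>F (G \<cdot> G \<cdot> ?HM) \<odot> F \<bullet> \<delta>G ?HM"
      by (subst l.law.naturality) simp_all+
    finally show "H \<bullet> composite_comult A G \<delta>G F \<delta>F l M \<odot> m ?GM \<odot> F \<bullet> k M =
        (m (G \<cdot> (F \<star> G) \<cdot> M) \<odot> F \<bullet> k ((F \<star> G) \<cdot> M)) \<odot> (F \<star> G) \<bullet> (m ?GM \<odot> F \<bullet> k M) \<odot>
        composite_comult A G \<delta>G F \<delta>F l ?HM"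
      by (simp add: composite_comult_def)

    have "\<epsilon>H ((F \<star> G) \<cdot> M) \<odot> m ?GM \<odot> F \<bullet> k M = (\<epsilon>H (F \<cdot> ?GM) \<odot> m ?GM) \<odot> F \<bullet> k M"
      by simp
    also have "\<dots> = F \<bullet> (\<epsilon>H ?GM \<odot> k M)"
      by (simp add: m.counit_G)
    finally show "\<epsilon>H ((F \<star> G) \<cdot> M) \<odot> m ?GM \<odot> F \<bullet> k M = (F \<star> G) \<bullet> \<epsilon>H M"
      by (simp add: k.counit_G)

    have "\<delta>H ((F \<star> G) \<cdot> M) \<odot> m ?GM \<odot> F \<bullet> k M = (\<delta>H (F \<cdot> ?GM) \<odot> m ?GM) \<odot> F \<bullet> k M"
      by simp
    also have "\<dots> = H \<bullet> m ?GM \<odot> m (H \<cdot> ?GM) \<odot> F \<bullet> (\<delta>H ?GM \<odot> k M)"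
      by (simp add: m.comult_G)
    also have "\<dots> = H \<bullet> m ?GM \<odot> (m (H \<cdot> ?GM) \<odot> (F \<star> H) \<bullet> k M) \<odot>
        F \<bullet> k ?HM \<odot> F \<bullet> G \<bullet> \<delta>H M"
      by (simp add: k.comult_G)
    also have "\<dots> = H \<bullet> m ?GM \<odot> ((H \<star> F) \<bullet> k M \<odot> m (G \<cdot> ?HM)) \<odot>
        F \<bullet> k ?HM \<odot> F \<bullet> G \<bullet> \<delta>H M"
      by (subst m.law.naturality) simp_all+
    finally show "\<delta>H ((F \<star> G) \<cdot> M) \<odot> m ?GM \<odot> F \<bullet> k M =
        H \<bullet> (m ?GM \<odot> F \<bullet> k M) \<odot> (m (G \<cdot> ?HM) \<odot> F \<bullet> k ?HM) \<odot> (F \<star> G) \<bullet> \<delta>H M"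
      by simp
  next
    fix f M N assume "f \<in> Hom A M N"
    then have f [simp]: "f \<in> Arr A" "Dom A f = M" "Cod A f = N"
      by (auto simp: Hom_def)
    then have [simp]: "M \<in> Obj A" "N \<in> Obj A"
      using l.G.Dom_Obj[of f] l.G.Cod_Obj[of f] by auto
    have "(m (G \<cdot> N) \<odot> F \<bullet> k N) \<odot> ((F \<star> G) \<star> H) \<bullet> f =
        m (G \<cdot> N) \<odot> F \<bullet> (k N \<odot> (G \<star> H) \<bullet> f)"
      by simp
    also have "\<dots> = (m (G \<cdot> N) \<odot> (F \<star> H) \<bullet> G \<bullet> f) \<odot> F \<bullet> k M"
      by (subst k.law.naturality) simp_all+
    also have "\<dots> = (H \<star> F \<star> G) \<bullet> f \<odot> m (G \<cdot> M) \<odot> F \<bullet> k M"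
      by (subst m.law.naturality) simp_all+
    finally show "(m (G \<cdot> N) \<odot> F \<bullet> k N) \<odot> ((F \<star> G) \<star> H) \<bullet> f =
        (H \<star> F \<star> G) \<bullet> f \<odot> m (G \<cdot> M) \<odot> F \<bullet> k M" .
  qed
qed

section \<open>Powers of a comonad with a strong braiding\<close>

context strong_braiding
begin

abbreviation "braid \<equiv> braid_seq A G t"
abbreviation "comult_pow \<equiv> comult_seq A G \<delta> t"
abbreviation "counit_pow \<equiv> counit_seq A G \<epsilon>"

lemma braiding_distributive_law: "distributive_law A G \<delta> \<epsilon> G \<delta> \<epsilon> t"
  by unfold_locales (simp_all add: G_counit counit_G G_comult comult_G)

lemma pow_endofunctor: "endofunctor A (G \<up> n)"
proof (induction n)
  case 0
  show ?case by unfold_locales auto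
next
  case (Suc n)
  then show ?case
    unfolding endo_pow_Suc by (rule endofunctor_comp) unfold_locales
qed

lemma comult_pow_Suc_Suc:
  "comult_pow (Suc (Suc n)) =
    composite_comult A G \<delta> (G \<up> Suc n) (comult_pow (Suc n)) (braid (Suc n))"
  by (rule ext) (simp add: composite_comult_def numeral_2_eq_2 endo_pow_Suc)

lemma counit_pow_Suc_Suc:
  "counit_pow (Suc (Suc n)) = composite_counit A \<epsilon> (G \<up> Suc n) (counit_pow (Suc n))"
  by (rule ext) (simp add: composite_counit_def)

text \<open>
  The hexagon is carried along because the step to \<open>t\<^bsub>n+1\<^esub>\<close> consumes the one for \<open>t\<^sub>n\<close>. Its own step
  is the braid picture of a crossing sliding past a longer strand: \<open>t\<close> passes the new crossing by
  Yang--Baxter and the rest of the strand by the induction hypothesis; naturality of \<open>t\<^sub>n\<close> brings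
  the crossings next to each other.
\<close>

lemma braid_distributive_law_and_hexagon:
  "distributive_law A G \<delta> \<epsilon> (G \<up> Suc n) (comult_pow (Suc n)) (counit_pow (Suc n)) (braid (Suc n)) \<and>
    (\<forall>M\<in>Obj A. G \<bullet> braid (Suc n) M \<odot> braid (Suc n) (G \<cdot> M) \<odot> (G \<up> Suc n) \<bullet> t M =
      t ((G \<up> Suc n) \<cdot> M) \<odot> G \<bullet> braid (Suc n) M \<odot> braid (Suc n) (G \<cdot> M))"
proof (induction n)
  case 0
  have "comult_pow (Suc 0) = \<delta>" "counit_pow (Suc 0) = \<epsilon>" "braid (Suc 0) = t"
    by (rule ext, simp)+
  then show ?case
    using braiding_distributive_law yang_baxter by simp
next
  case (Suc n)
  define F where "F = G \<up> Suc n"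
  let ?s = "braid (Suc n)"
  interpret s: distributive_law A G \<delta> \<epsilon> F "comult_pow (Suc n)" "counit_pow (Suc n)" ?s
    using Suc unfolding F_def by blast
  have hexagon: "G \<bullet> ?s M \<odot> ?s (G \<cdot> M) \<odot> F \<bullet> t M = t (F \<cdot> M) \<odot> G \<bullet> ?s M \<odot> ?s (G \<cdot> M)"
    if "M \<in> Obj A" for M
    using Suc that unfolding F_def by blast
  have braid_Suc: "braid (Suc (Suc n)) = (\<lambda>M. ?s (G \<cdot> M) \<odot> F \<bullet> t M)"
    by (rule ext) (simp add: F_def)
  have pow: "G \<up> Suc (Suc n) = F \<star> G"
    unfolding F_def by (rule endo_pow_Suc)
  have "distributive_law A G \<delta> \<epsilon> (G \<up> Suc (Suc n))
      (comult_pow (Suc (Suc n))) (counit_pow (Suc (Suc n))) (braid (Suc (Suc n)))"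
    unfolding comult_pow_Suc_Suc counit_pow_Suc_Suc braid_Suc pow F_def[symmetric]
    by (rule composite_distributive_law[OF _ braiding_distributive_law])
      (rule s.distributive_law_axioms hexagon | assumption)+
  moreover have "G \<bullet> braid (Suc (Suc n)) M \<odot> braid (Suc (Suc n)) (G \<cdot> M) \<odot>
        (G \<up> Suc (Suc n)) \<bullet> t M =
      t ((G \<up> Suc (Suc n)) \<cdot> M) \<odot> G \<bullet> braid (Suc (Suc n)) M \<odot> braid (Suc (Suc n)) (G \<cdot> M)"
    if M [simp]: "M \<in> Obj A" for M
  proof -
    let ?GM = "G \<cdot> M" and ?GGM = "G \<cdot> G \<cdot> M"
    have "G \<bullet> (?s ?GM \<odot> F \<bullet> t M) \<odot> (?s ?GGM \<odot> F \<bullet> t ?GM) \<odot> F \<bullet> G \<bullet> t M =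
        G \<bullet> ?s ?GM \<odot> ((G \<star> F) \<bullet> t M \<odot> ?s ?GGM) \<odot> F \<bullet> t ?GM \<odot> F \<bullet> G \<bullet> t M"
      by simp
    also have "\<dots> = G \<bullet> ?s ?GM \<odot> (?s ?GGM \<odot> (F \<star> G) \<bullet> t M) \<odot> F \<bullet> t ?GM \<odot> F \<bullet> G \<bullet> t M"
      by (subst s.law.naturality[symmetric]) simp_all+
    also have "\<dots> = G \<bullet> ?s ?GM \<odot> ?s ?GGM \<odot> F \<bullet> (G \<bullet> t M \<odot> t ?GM \<odot> G \<bullet> t M)"
      by simp
    also have "\<dots> = G \<bullet> ?s ?GM \<odot> ?s ?GGM \<odot> F \<bullet> (t ?GM \<odot> G \<bullet> t M \<odot> t ?GM)"
      by (simp only: yang_baxter M)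
    also have "\<dots> = (G \<bullet> ?s ?GM \<odot> ?s ?GGM \<odot> F \<bullet> t ?GM) \<odot> F \<bullet> G \<bullet> t M \<odot> F \<bullet> t ?GM"
      by simp
    also have "\<dots> = (t (F \<cdot> ?GM) \<odot> G \<bullet> ?s ?GM \<odot> ?s ?GGM) \<odot> F \<bullet> G \<bullet> t M \<odot> F \<bullet> t ?GM"
      by (simp only: hexagon M omap_Obj)
    also have "\<dots> = t (F \<cdot> ?GM) \<odot> G \<bullet> ?s ?GM \<odot> (?s ?GGM \<odot> (F \<star> G) \<bullet> t M) \<odot> F \<bullet> t ?GM"
      by simp
    also have "\<dots> = t (F \<cdot> ?GM) \<odot> G \<bullet> ?s ?GM \<odot> ((G \<star> F) \<bullet> t M \<odot> ?s ?GGM) \<odot> F \<bullet> t ?GM"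
      by (subst s.law.naturality) simp_all+
    also have "\<dots> = t (F \<cdot> ?GM) \<odot> G \<bullet> (?s ?GM \<odot> F \<bullet> t M) \<odot> ?s ?GGM \<odot> F \<bullet> t ?GM"
      by simp
    finally show ?thesis
      unfolding braid_Suc pow by simp
  qed
  ultimately show ?case by blast
qed

theorem braid_distributive_law:
  assumes "n \<ge> 1"
  shows "distributive_law A G \<delta> \<epsilon> (G \<up> n) (comult_pow n) (counit_pow n) (braid n)"
  using braid_distributive_law_and_hexagon[of "n - 1"] assms by simp

lemma pow_comonad:
  assumes "n \<ge> 1"
  shows "comonad A (G \<up> n) (comult_pow n) (counit_pow n)"
  using braid_distributive_law[OF assms] by (simp add: distributive_law_def)

lemma braid_Arr [simp]:
  assumes M: "M \<in> Obj A"
  shows "braid n M \<in> Arr A" "Dom A (braid n M) = (G \<up> n) \<cdot> G \<cdot> M"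
    "Cod A (braid n M) = G \<cdot> (G \<up> n) \<cdot> M"
proof -
  interpret d: distributive_law A G \<delta> \<epsilon> "G \<up> Suc m" "comult_pow (Suc m)" "counit_pow (Suc m)"
    "braid (Suc m)" for m
    by (rule braid_distributive_law) simp
  show "braid n M \<in> Arr A" "Dom A (braid n M) = (G \<up> n) \<cdot> G \<cdot> M"
    "Cod A (braid n M) = G \<cdot> (G \<up> n) \<cdot> M"
    using d.law.component_Arr[OF M, of "n - 1"] M by (cases n; simp)+
qed

text \<open>
  On objects the recursion also holds at \<open>n = 0\<close>, since \<open>t\<^sub>0\<close> is the identity there.
\<close>

lemma braid_Suc:
  "M \<in> Obj A \<Longrightarrow> braid (Suc n) M = braid n (G \<cdot> M) \<odot> (G \<up> n) \<bullet> t M"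
  by (cases n) simp_all

lemma braid_add:
  assumes "M \<in> Obj A"
  shows "braid (m + n) M = braid m ((G \<up> n) \<cdot> M) \<odot> (G \<up> m) \<bullet> braid n M"
  using assms
proof (induction n arbitrary: M)
  case 0
  interpret m: endofunctor A "G \<up> m" by (rule pow_endofunctor)
  show ?case using 0 by simp
next
  case (Suc n)
  interpret m: endofunctor A "G \<up> m" by (rule pow_endofunctor)
  interpret n: endofunctor A "G \<up> n" by (rule pow_endofunctor)
  show ?case
    using Suc by (simp add: braid_Suc endo_pow_add endo_pow_Suc endo_pow_swap)
qed

text \<open>
  The two formulas for \<open>\<delta>\<^bsup>(n+1)\<^esup>\<close> differ by naturality of \<open>\<delta>\<^bsup>(n)\<^esup>\<close> with respect to \<open>\<delta>\<close>.
\<close>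

lemma comult_pow_alternative:
  assumes M [simp]: "M \<in> Obj A" and "n \<ge> 1"
  shows "comult_pow (Suc n) M =
    (G \<up> n) \<bullet> braid n (G \<cdot> M) \<odot> (G \<up> (n + n)) \<bullet> \<delta> M \<odot> comult_pow n (G \<cdot> M)"
proof -
  obtain k where n: "n = Suc k"
    using assms by (cases n) auto
  interpret n: comonad A "G \<up> n" "comult_pow n" "counit_pow n"
    using assms by (intro pow_comonad)
  have "comult_pow n (G \<cdot> G \<cdot> M) \<odot> (G \<up> n) \<bullet> \<delta> M =
      (G \<up> n \<star> G \<up> n) \<bullet> \<delta> M \<odot> comult_pow n (G \<cdot> M)"
    by (rule n.comult.naturality) simp_all+
  then show ?thesis
    by (simp add: n comult_pow_Suc_Suc composite_comult_def flip: endo_pow_add)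
qed

lemma counit_pow_foldr:
  assumes [simp]: "M \<in> Obj A"
  shows "counit_pow n M = foldr (\<lambda>k h. (G \<up> k) \<bullet> \<epsilon> M \<odot> h) [0..<n] (Ide A ((G \<up> n) \<cdot> M))"
proof -
  have Arr: "(G \<up> n) \<bullet> \<epsilon> M \<in> Arr A" "Dom A ((G \<up> n) \<bullet> \<epsilon> M) = (G \<up> Suc n) \<cdot> M"
    "Cod A ((G \<up> n) \<bullet> \<epsilon> M) = (G \<up> n) \<cdot> M" "(G \<up> n) \<cdot> M \<in> Obj A" for n
  proof -
    interpret n: endofunctor A "G \<up> n" by (rule pow_endofunctor)
    show "(G \<up> n) \<bullet> \<epsilon> M \<in> Arr A" "Dom A ((G \<up> n) \<bullet> \<epsilon> M) = (G \<up> Suc n) \<cdot> M"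
      "Cod A ((G \<up> n) \<bullet> \<epsilon> M) = (G \<up> n) \<cdot> M" "(G \<up> n) \<cdot> M \<in> Obj A"
      by (simp_all add: endo_pow_Suc)
  qed
  have Suc: "counit_pow (Suc n) M = counit_pow n M \<odot> (G \<up> n) \<bullet> \<epsilon> M" for n
    by (cases n) simp_all
  have counit: "counit_pow n M \<in> Arr A \<and> Dom A (counit_pow n M) = (G \<up> n) \<cdot> M" for n
    by (induction n) (simp_all add: Suc Arr)
  \<comment> \<open>The fold starts from an arbitrary arrow, because passing from \<open>n\<close> to \<open>n + 1\<close> changes
    its innermost argument.\<close>
  have "foldr (\<lambda>k h. (G \<up> k) \<bullet> \<epsilon> M \<odot> h) [0..<n] h = counit_pow n M \<odot> h \<and>
      counit_pow n M \<odot> h \<in> Arr A"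
    if "h \<in> Arr A" "Cod A h = (G \<up> n) \<cdot> M" for h n
    using that
  proof (induction n arbitrary: h)
    case 0
    then show ?case by simp
  next
    case (Suc n)
    with Suc.IH[of "(G \<up> n) \<bullet> \<epsilon> M \<odot> h"] show ?case
      by (simp add: \<open>\<And>n. counit_pow (Suc n) M = counit_pow n M \<odot> (G \<up> n) \<bullet> \<epsilon> M\<close> Arr counit)
  qed
  then show ?thesis
    using counit by (simp add: Arr)
qed

lemma braid_natural:
  assumes f [simp]: "f \<in> Arr A" "Dom A f = M" "Cod A f = N"
  shows "braid n N \<odot> (G \<up> n) \<bullet> G \<bullet> f = G \<bullet> (G \<up> n) \<bullet> f \<odot> braid n M"
proof (cases n)
  case 0
  have "M \<in> Obj A" "N \<in> Obj A"
    using f Dom_Obj[of f] Cod_Obj[of f] by auto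
  with 0 show ?thesis by simp
next
  case (Suc m)
  interpret d: distributive_law A G \<delta> \<epsilon> "G \<up> n" "comult_pow n" "counit_pow n" "braid n"
    using Suc by (intro braid_distributive_law) simp
  show ?thesis
    using d.law.naturality[OF f] by simp
qed

lemma braid_comult_pow:
  assumes M [simp]: "M \<in> Obj A" and "1 \<le> l" "l \<le> n"
  shows "(G \<up> (n - l + 1)) \<bullet> comult_pow l M \<odot> braid n M =
    braid (n + l) M \<odot> (G \<up> (n - l)) \<bullet> comult_pow l (G \<cdot> M)"
proof -
  obtain k where n: "n = k + l"
    using \<open>l \<le> n\<close> le_Suc_ex by (metis add.commute)
  interpret k: endofunctor A "G \<up> k" by (rule pow_endofunctor)
  interpret l: distributive_law A G \<delta> \<epsilon> "G \<up> l" "comult_pow l" "counit_pow l" "braid l"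
    using \<open>1 \<le> l\<close> by (rule braid_distributive_law)
  let ?M = "(G \<up> l) \<cdot> M"
  have "(G \<up> (n - l + 1)) \<bullet> comult_pow l M \<odot> braid n M =
      (G \<bullet> (G \<up> k) \<bullet> comult_pow l M \<odot> braid k ?M) \<odot> (G \<up> k) \<bullet> braid l M"
    by (simp add: n braid_add endo_pow_Suc endo_pow_swap)
  also have "\<dots> = (braid k ((G \<up> l) \<cdot> ?M) \<odot> (G \<up> k) \<bullet> G \<bullet> comult_pow l M) \<odot>
      (G \<up> k) \<bullet> braid l M"
    by (subst braid_natural[symmetric]) simp_all+
  also have "\<dots> = braid k ((G \<up> l) \<cdot> ?M) \<odot> (G \<up> k) \<bullet> (G \<bullet> comult_pow l M \<odot> braid l M)"
    by (simp add: endo_pow_swap)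
  also have "\<dots> = braid k ((G \<up> l) \<cdot> ?M) \<odot> (G \<up> k) \<bullet>
      (braid (l + l) M \<odot> comult_pow l (G \<cdot> M))"
    by (simp add: l.comult_F braid_add)
  also have "\<dots> = braid (k + (l + l)) M \<odot> (G \<up> k) \<bullet> comult_pow l (G \<cdot> M)"
    by (simp add: braid_add[of M k] endo_pow_add endo_pow_swap)
  finally show ?thesis
    by (simp add: n add.assoc)
qed

end

theorem theorem4:
  fixes A :: "('o, 'm, 'x) cat_scheme" (structure)
    and G :: "('o, 'm) endo"
    and \<delta> \<epsilon> t :: "'o \<Rightarrow> 'm"
  assumes "comonad A G \<delta> \<epsilon>"
    and "strong_braiding A G \<delta> \<epsilon> t"
  shows
    "(\<forall>n\<ge>1. comonad A (G \<up> n) (comult_seq A G \<delta> t n) (counit_seq A G \<epsilon> n)) \<and>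
     (\<forall>n\<ge>1. distributive_law A G \<delta> \<epsilon>
        (G \<up> n) (comult_seq A G \<delta> t n) (counit_seq A G \<epsilon> n) (braid_seq A G t n)) \<and>
     (\<forall>n\<ge>2. \<forall>M\<in>Obj A.
        comult_seq A G \<delta> t n M =
          amap (G \<up> (n - 1)) (braid_seq A G t (n - 1) (omap G M)) \<odot>
          comult_seq A G \<delta> t (n - 1) (omap (G \<up> 2) M) \<odot>
          amap (G \<up> (n - 1)) (\<delta> M) \<and>
        comult_seq A G \<delta> t n M =
          amap (G \<up> (n - 1)) (braid_seq A G t (n - 1) (omap G M)) \<odot>
          amap (G \<up> (2 * n - 2)) (\<delta> M) \<odot>
          comult_seq A G \<delta> t (n - 1) (omap G M)) \<and>
     (\<forall>n\<ge>1. \<forall>M\<in>Obj A.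
        counit_seq A G \<epsilon> n M =
          foldr (\<lambda>k h. amap (G \<up> k) (\<epsilon> M) \<odot> h) [0..<n] (Ide A (omap (G \<up> n) M))) \<and>
     (\<forall>n\<ge>1. \<forall>M\<in>Obj A.
        amap G (comult_seq A G \<delta> t n M) \<odot> braid_seq A G t n M =
          braid_seq A G t n (omap (G \<up> n) M) \<odot>
          amap (G \<up> n) (braid_seq A G t n M) \<odot>
          comult_seq A G \<delta> t n (omap G M)) \<and>
     (\<forall>n\<ge>1. \<forall>M\<in>Obj A.
        \<delta> (omap (G \<up> n) M) \<odot> braid_seq A G t n M =
          amap G (braid_seq A G t n M) \<odot>
          braid_seq A G t n (omap G M) \<odot>
          amap (G \<up> n) (\<delta> M)) \<and>
     (\<forall>n\<ge>1. \<forall>M\<in>Obj A.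
        counit_seq A G \<epsilon> n (omap G M) =
          amap G (counit_seq A G \<epsilon> n M) \<odot> braid_seq A G t n M) \<and>
     (\<forall>n\<ge>1. \<forall>M\<in>Obj A.
        amap (G \<up> n) (\<epsilon> M) = \<epsilon> (omap (G \<up> n) M) \<odot> braid_seq A G t n M) \<and>
     (\<forall>n l. 1 \<le> l \<and> l \<le> n \<longrightarrow> (\<forall>M\<in>Obj A.
        amap (G \<up> (n - l + 1)) (comult_seq A G \<delta> t l M) \<odot> braid_seq A G t n M =
          braid_seq A G t (n + l) M \<odot>
          amap (G \<up> (n - l)) (comult_seq A G \<delta> t l (omap G M)))) \<and>
     (\<forall>n\<ge>1. \<forall>M\<in>Obj A.
        braid_seq A G t (n + n) M =
          braid_seq A G t n (omap (G \<up> n) M) \<odot> amap (G \<up> n) (braid_seq A G t n M))"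
proof -
  interpret strong_braiding A G \<delta> \<epsilon> t by fact
  note law = braid_distributive_law
  note law_axioms = distributive_law.counit_F[OF law] distributive_law.comult_F[OF law]
    distributive_law.counit_G[OF law] distributive_law.comult_G[OF law]
  have comult_unfold: "comult_pow n M =
      (G \<up> (n - 1)) \<bullet> braid (n - 1) (G \<cdot> M) \<odot>
      comult_pow (n - 1) ((G \<up> 2) \<cdot> M) \<odot> (G \<up> (n - 1)) \<bullet> \<delta> M"
    if "n \<ge> 2" for n M
    using that comult_seq.simps(3)[of A G \<delta> t "n - 2" M] by (simp add: Suc_diff_Suc numeral_2_eq_2)
  have comult_unfold': "comult_pow n M =
      (G \<up> (n - 1)) \<bullet> braid (n - 1) (G \<cdot> M) \<odot>
      (G \<up> (2 * n - 2)) \<bullet> \<delta> M \<odot> comult_pow (n - 1) (G \<cdot> M)"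
    if "n \<ge> 2" "M \<in> Obj A" for n M
  proof -
    have "n - 1 + (n - 1) = 2 * n - 2" "Suc (n - 1) = n"
      using that by auto
    with comult_pow_alternative[of M "n - 1"] that show ?thesis
      by simp
  qed
  show ?thesis
    by (intro conjI allI ballI impI)
      (use pow_comonad law comult_unfold comult_unfold' counit_pow_foldr law_axioms
        braid_comult_pow braid_add in auto)
qed

end
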